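(* Let $(E,\pi,i)$ be a diffeological profinite family indexed by a non-empty directed set $(A,\le)$, and suppose each $E_J$ ($J\in A$) is equipped with a distance $d_J$ such that $d_J=d_K\circ(i_K^J\times i_K^J)$ whenever $J\le K$. Equip $E^A$ with the distance $d_E^\infty=\sup_{J\in A}\frac{d_J}{1+d_J}$. If $E^A$ is compact, then the set of polynomials of cylindrical maps $$\bigcup_{n\in\mathbb N,\ n\ge 1}\left\{P\circ(f_1,\dots,f_n)\ :\ P\in\mathbb R[X_1,\dots,X_n],\ (f_1,\dots,f_n)\in Cyl(E_A)^n\right\}$$ is dense in $C^0(E^A,\mathbb R)$ for the topology of uniform convergence.
   Context: Directed set: a partially ordered set in which any two elements have a common upper bound. A projective family $(E,\pi)$ indexed by $A$ consists of non-empty sets $E_J$ and surjective maps $\pi_J^K:E_K\to E_J$ for $J\le K$, with $\pi_K^K=\mathrm{Id}$ and $\pi_J^L=\pi_J^K\circ\pi_K^L$ for $J\le K\le L$. A profinite family $(E,\pi,i)$ is a projective family in which each $E_J$ is a finite-dimensional manifold, together with injective maps $i_K^J:E_J\to E_K$ for $J\le K$ with $\pi_J^K\circ i_K^J=\mathrm{Id}_{E_J}$ and $i_K^J\circ i_J^I=i_K^I$ for $I\le J\le K$; it is diffeological if all these maps are smooth. Product limit set: $E^A=\{(x_J)\in\prod_J E_J : x_J=\pi_J^K(x_K)\ \forall J\le K\}$. A section of $A$ is a non-empty subset $\mathcal S\subset A$ such that (a) for $I,J\in\mathcal S$, $I\ne J$ iff $I\not\le J$ and $J\not\le I$; (b)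 every $I\in A$ is comparable to some $S\in\mathcal S$. $Sec(A)$ is the set of sections. $E_{\mathcal S}$ is the set of $(x_I)\in E^A$ such that for every $I\in A$ there is $S\in\mathcal S$ comparable to $I$ with $x_I=i_I^S(x_S)$ if $S\le I$ and $x_I=\pi_I^S(x_S)$ if $I\le S$; $E_A=\bigcup_{\mathcal S\in Sec(A)}E_{\mathcal S}$. For $x,y\in E^A$, $d_J(x,y)$ means $d_J(x_J,y_J)$. Smoothness: $E^A$ has the subset diffeology of the product diffeology of $\prod_J E_J$ (a map from an open subset of a Euclidean space is a plot iff all its components are smooth), $E_A$ the subset diffeology of $E^A$; a real function is smooth if its composition with every plot is smooth. Cylindrical functions: $f\in C^\infty(E^A,\mathbb R)$ (resp. $C^\infty(E_A,\mathbb R)$) is cylindrical if there is $\mathcal S_f\in Sec(A)$ such that for every $(x_I)$ in $E^A$ (resp. $E_A$), $f((x_I)_{I\in A})=f((y_I)_{I\in A})$, where $(y_I)_{I\in A}$ is an element of $E^A$ (resp. $E_A$) with $y_I=x_I$ if there is $S\in\mathcal S_f$ with $I\le S$, and $y_I=i_I^S\circ\pi_S^I(x_I)$ for $S\in\mathcal S_f$ with $S\le I$. $Cyl(E^A)$, $Cyl(E_A)$ denote the sets of cylindrical functions; elements of $Cyl(E_A)$ are identified with functions on $E^A$ through the identification $Cyl(E^A)=Cyl(E_A)$ given by restriction.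
   Formalization: Each distance d_J is assumed to induce the manifold topology of E_J (otherwise the claim fails); f(x)=f(y) is required for every y with the prescribed coordinates, and "dense" means that the continuous members of the set are dense in C^0, since not all members need be continuous. *)

theory Defs
  imports "HOL-Analysis.Analysis" "HOL-Library.Poly_Mapping"
begin

section \<open>Smooth maps and manifolds\<close>

text \<open>
  The dimension of a manifold depends on the index \<open>J \<in> A\<close> and may be unbounded, so \<open>\<real>\<^sup>n\<close> cannot
  be a type here. It is the topological space \<^const>\<open>Euclidean_space\<close> \<open>n\<close>, whose points are the
  sequences that vanish from index \<open>n\<close> on.
\<close>

definition partial_deriv :: "nat \<Rightarrow> ((nat \<Rightarrow> real) \<Rightarrow> real) \<Rightarrow> (nat \<Rightarrow> real) \<Rightarrow> real" where
  "partial_deriv i f x = deriv (\<lambda>t. f (x(i := t))) (x i)"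

primrec Ck_on :: "nat \<Rightarrow> nat \<Rightarrow> (nat \<Rightarrow> real) set \<Rightarrow> ((nat \<Rightarrow> real) \<Rightarrow> real) \<Rightarrow> bool" where
  "Ck_on n 0 U f \<longleftrightarrow> continuous_map (subtopology (Euclidean_space n) U) euclideanreal f"
| "Ck_on n (Suc k) U f \<longleftrightarrow>
     continuous_map (subtopology (Euclidean_space n) U) euclideanreal f \<and>
     (\<forall>i<n. (\<forall>x\<in>U. (\<lambda>t. f (x(i := t))) differentiable (at (x i))) \<and>
            Ck_on n k U (partial_deriv i f))"

text \<open>Only meaningful for \<open>U\<close> open in \<open>\<real>\<^sup>n\<close>.\<close>

definition smooth_real_on :: "nat \<Rightarrow> (nat \<Rightarrow> real) set \<Rightarrow> ((nat \<Rightarrow> real) \<Rightarrow> real) \<Rightarrow> bool" where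
  "smooth_real_on n U f \<longleftrightarrow> (\<forall>k. Ck_on n k U f)"

record 'e manifold =
  mtop :: "'e topology"
  mdim :: nat
  atlas :: "('e set \<times> ('e \<Rightarrow> nat \<Rightarrow> real)) set"

definition is_chart :: "'e topology \<Rightarrow> nat \<Rightarrow> 'e set \<Rightarrow> ('e \<Rightarrow> nat \<Rightarrow> real) \<Rightarrow> bool" where
  "is_chart X n U \<phi> \<longleftrightarrow>
     openin X U \<and> openin (Euclidean_space n) (\<phi> ` U) \<and>
     homeomorphic_map (subtopology X U) (subtopology (Euclidean_space n) (\<phi> ` U)) \<phi>"

definition smooth_manifold :: "'e manifold \<Rightarrow> bool" where
  "smooth_manifold M \<longleftrightarrow>
     Hausdorff_space (mtop M) \<and> second_countable (mtop M) \<and>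
     (\<forall>(U, \<phi>)\<in>atlas M. is_chart (mtop M) (mdim M) U \<phi>) \<and>
     (\<Union>(U, \<phi>)\<in>atlas M. U) = topspace (mtop M) \<and>
     (\<forall>(U, \<phi>)\<in>atlas M. \<forall>(V, \<psi>)\<in>atlas M. \<forall>i<mdim M.
        smooth_real_on (mdim M) (\<phi> ` (U \<inter> V)) (\<lambda>u. \<psi> (inv_into U \<phi> u) i))"

definition smooth_param :: "nat \<Rightarrow> (nat \<Rightarrow> real) set \<Rightarrow> 'e manifold \<Rightarrow> ((nat \<Rightarrow> real) \<Rightarrow> 'e) \<Rightarrow> bool" where
  "smooth_param n U M p \<longleftrightarrow>
     continuous_map (subtopology (Euclidean_space n) U) (mtop M) p \<and>
     (\<forall>(V, \<psi>)\<in>atlas M. \<forall>i<mdim M. smooth_real_on n {u\<in>U. p u \<in> V} (\<lambda>u. \<psi> (p u) i))"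

definition smooth_map :: "'e manifold \<Rightarrow> 'f manifold \<Rightarrow> ('e \<Rightarrow> 'f) \<Rightarrow> bool" where
  "smooth_map M N f \<longleftrightarrow>
     f \<in> topspace (mtop M) \<rightarrow> topspace (mtop N) \<and>
     (\<forall>(U, \<phi>)\<in>atlas M. smooth_param (mdim M) (\<phi> ` U) N (\<lambda>u. f (inv_into U \<phi> u)))"


section \<open>Projective and profinite families\<close>

definition directed :: "'i::order set \<Rightarrow> bool" where
  "directed A \<longleftrightarrow> (\<forall>I\<in>A. \<forall>J\<in>A. \<exists>K\<in>A. I \<le> K \<and> J \<le> K)"

text \<open>\<open>\<pi> J K\<close> is the projection from \<open>E K\<close> to \<open>E J\<close>, and \<open>\<iota> K J\<close> the injection from \<open>E J\<close> to \<open>E K\<close>,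
  for \<open>J \<le> K\<close>.\<close>

locale projective_fam =
  fixes A :: "'i::order set" and E :: "'i \<Rightarrow> 'e set" and \<pi> :: "'i \<Rightarrow> 'i \<Rightarrow> 'e \<Rightarrow> 'e"
  assumes nonempty: "J \<in> A \<Longrightarrow> E J \<noteq> {}"
    and proj_surj: "\<lbrakk>J \<in> A; K \<in> A; J \<le> K\<rbrakk> \<Longrightarrow> \<pi> J K ` E K = E J"
    and proj_id: "\<lbrakk>K \<in> A; x \<in> E K\<rbrakk> \<Longrightarrow> \<pi> K K x = x"
    and proj_comp: "\<lbrakk>J \<in> A; K \<in> A; L \<in> A; J \<le> K; K \<le> L; x \<in> E L\<rbrakk> \<Longrightarrow> \<pi> J L x = \<pi> J K (\<pi> K L x)"

locale profinite_fam = projective_fam A E \<pi>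
  for A :: "'i::order set" and E :: "'i \<Rightarrow> 'e set" and \<pi> :: "'i \<Rightarrow> 'i \<Rightarrow> 'e \<Rightarrow> 'e" +
  fixes M :: "'i \<Rightarrow> 'e manifold" and \<iota> :: "'i \<Rightarrow> 'i \<Rightarrow> 'e \<Rightarrow> 'e"
  assumes manifold: "J \<in> A \<Longrightarrow> smooth_manifold (M J)"
    and carrier: "J \<in> A \<Longrightarrow> topspace (mtop (M J)) = E J"
    and inj_into: "\<lbrakk>J \<in> A; K \<in> A; J \<le> K\<rbrakk> \<Longrightarrow> \<iota> K J \<in> E J \<rightarrow> E K"
    and inj_inj: "\<lbrakk>J \<in> A; K \<in> A; J \<le> K\<rbrakk> \<Longrightarrow> inj_on (\<iota> K J) (E J)"
    and proj_inj: "\<lbrakk>J \<in> A; K \<in> A; J \<le> K; x \<in> E J\<rbrakk> \<Longrightarrow> \<pi> J K (\<iota> K J x) = x"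
    and inj_comp: "\<lbrakk>I \<in> A; J \<in> A; K \<in> A; I \<le> J; J \<le> K; x \<in> E I\<rbrakk> \<Longrightarrow> \<iota> K J (\<iota> J I x) = \<iota> K I x"

locale diffeological_profinite_fam = profinite_fam A E \<pi> M \<iota>
  for A :: "'i::order set" and E :: "'i \<Rightarrow> 'e set" and \<pi> :: "'i \<Rightarrow> 'i \<Rightarrow> 'e \<Rightarrow> 'e"
    and M :: "'i \<Rightarrow> 'e manifold" and \<iota> :: "'i \<Rightarrow> 'i \<Rightarrow> 'e \<Rightarrow> 'e" +
  assumes proj_smooth: "\<lbrakk>J \<in> A; K \<in> A; J \<le> K\<rbrakk> \<Longrightarrow> smooth_map (M K) (M J) (\<pi> J K)"
    and inj_smooth: "\<lbrakk>J \<in> A; K \<in> A; J \<le> K\<rbrakk> \<Longrightarrow> smooth_map (M J) (M K) (\<iota> K J)"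

definition product_limit ::
  "'i::order set \<Rightarrow> ('i \<Rightarrow> 'e set) \<Rightarrow> ('i \<Rightarrow> 'i \<Rightarrow> 'e \<Rightarrow> 'e) \<Rightarrow> ('i \<Rightarrow> 'e) set" where
  "product_limit A E \<pi> = {x \<in> Pi\<^sub>E A E. \<forall>J\<in>A. \<forall>K\<in>A. J \<le> K \<longrightarrow> x J = \<pi> J K (x K)}"

definition Sec :: "'i::order set \<Rightarrow> 'i set set" where
  "Sec A = {S. S \<noteq> {} \<and> S \<subseteq> A \<and>
               (\<forall>I\<in>S. \<forall>J\<in>S. I \<noteq> J \<longleftrightarrow> \<not> I \<le> J \<and> \<not> J \<le> I) \<and>
               (\<forall>I\<in>A. \<exists>s\<in>S. I \<le> s \<or> s \<le> I)}"

definition section_limit ::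
  "'i::order set \<Rightarrow> ('i \<Rightarrow> 'e set) \<Rightarrow> ('i \<Rightarrow> 'i \<Rightarrow> 'e \<Rightarrow> 'e) \<Rightarrow> ('i \<Rightarrow> 'i \<Rightarrow> 'e \<Rightarrow> 'e) \<Rightarrow>
   'i set \<Rightarrow> ('i \<Rightarrow> 'e) set" where
  "section_limit A E \<pi> \<iota> S =
     {x \<in> product_limit A E \<pi>. \<forall>I\<in>A. \<exists>s\<in>S. (s \<le> I \<or> I \<le> s) \<and>
        (s \<le> I \<longrightarrow> x I = \<iota> I s (x s)) \<and> (I \<le> s \<longrightarrow> x I = \<pi> I s (x s))}"

definition profinite_limit ::
  "'i::order set \<Rightarrow> ('i \<Rightarrow> 'e set) \<Rightarrow> ('i \<Rightarrow> 'i \<Rightarrow> 'e \<Rightarrow> 'e) \<Rightarrow> ('i \<Rightarrow> 'i \<Rightarrow> 'e \<Rightarrow> 'e) \<Rightarrow>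
   ('i \<Rightarrow> 'e) set" where
  "profinite_limit A E \<pi> \<iota> = (\<Union>S\<in>Sec A. section_limit A E \<pi> \<iota> S)"


section \<open>Smooth and cylindrical functions\<close>

text \<open>Plots of a set \<open>X\<close> of families, for the subset diffeology of the product diffeology.\<close>

definition plot ::
  "'i set \<Rightarrow> ('i \<Rightarrow> 'e manifold) \<Rightarrow> ('i \<Rightarrow> 'e) set \<Rightarrow> nat \<Rightarrow> (nat \<Rightarrow> real) set \<Rightarrow>
   ((nat \<Rightarrow> real) \<Rightarrow> 'i \<Rightarrow> 'e) \<Rightarrow> bool" where
  "plot A M X n U p \<longleftrightarrow>
     openin (Euclidean_space n) U \<and> p \<in> U \<rightarrow> X \<and> (\<forall>J\<in>A. smooth_param n U (M J) (\<lambda>u. p u J))"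

definition smooth_functions ::
  "'i set \<Rightarrow> ('i \<Rightarrow> 'e manifold) \<Rightarrow> ('i \<Rightarrow> 'e) set \<Rightarrow> (('i \<Rightarrow> 'e) \<Rightarrow> real) set" where
  "smooth_functions A M X =
     {f \<in> extensional X. \<forall>n U p. plot A M X n U p \<longrightarrow> smooth_real_on n U (\<lambda>u. f (p u))}"

text \<open>
  For a section \<open>S\<close>, \<open>section_projection A \<pi> \<iota> S x y\<close> says that \<open>y\<close> has the coordinates prescribed
  by \<open>x\<close> and \<open>S\<close>. If some index lies above several elements of \<open>S\<close>, these prescriptions can be
  incompatible, so that for a given \<open>x\<close> there need not be such a \<open>y\<close>. A cylindrical function has to
  satisfy \<open>f x = f y\<close> for every \<open>y\<close> that does have these coordinates.
\<close>

definition section_projection ::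
  "'i::order set \<Rightarrow> ('i \<Rightarrow> 'i \<Rightarrow> 'e \<Rightarrow> 'e) \<Rightarrow> ('i \<Rightarrow> 'i \<Rightarrow> 'e \<Rightarrow> 'e) \<Rightarrow> 'i set \<Rightarrow>
   ('i \<Rightarrow> 'e) \<Rightarrow> ('i \<Rightarrow> 'e) \<Rightarrow> bool" where
  "section_projection A \<pi> \<iota> S x y \<longleftrightarrow>
     (\<forall>I\<in>A. \<forall>s\<in>S. (I \<le> s \<longrightarrow> y I = x I) \<and> (s \<le> I \<longrightarrow> y I = \<iota> I s (\<pi> s I (x I))))"

definition Cyl ::
  "'i::order set \<Rightarrow> ('i \<Rightarrow> 'e manifold) \<Rightarrow> ('i \<Rightarrow> 'i \<Rightarrow> 'e \<Rightarrow> 'e) \<Rightarrow> ('i \<Rightarrow> 'i \<Rightarrow> 'e \<Rightarrow> 'e) \<Rightarrow>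
   ('i \<Rightarrow> 'e) set \<Rightarrow> (('i \<Rightarrow> 'e) \<Rightarrow> real) set" where
  "Cyl A M \<pi> \<iota> X =
     {f \<in> smooth_functions A M X.
        \<exists>S\<in>Sec A. \<forall>x\<in>X. \<forall>y\<in>X. section_projection A \<pi> \<iota> S x y \<longrightarrow> f x = f y}"

text \<open>The elements of \<open>Cyl(E_A)\<close>, seen as functions on \<open>E^A\<close>: the cylindrical functions on \<open>E^A\<close>
  whose restriction to \<open>E_A\<close> is a cylindrical function on \<open>E_A\<close>.\<close>

definition Cyl_on_limit ::
  "'i::order set \<Rightarrow> ('i \<Rightarrow> 'e set) \<Rightarrow> ('i \<Rightarrow> 'e manifold) \<Rightarrow> ('i \<Rightarrow> 'i \<Rightarrow> 'e \<Rightarrow> 'e) \<Rightarrow>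
   ('i \<Rightarrow> 'i \<Rightarrow> 'e \<Rightarrow> 'e) \<Rightarrow> (('i \<Rightarrow> 'e) \<Rightarrow> real) set" where
  "Cyl_on_limit A E M \<pi> \<iota> =
     {f \<in> Cyl A M \<pi> \<iota> (product_limit A E \<pi>).
        restrict f (profinite_limit A E \<pi> \<iota>) \<in> Cyl A M \<pi> \<iota> (profinite_limit A E \<pi> \<iota>)}"


section \<open>Polynomials of cylindrical functions\<close>

text \<open>A polynomial maps each monomial, given by its exponents, to its coefficient.\<close>

type_synonym real_mpoly = "(nat \<Rightarrow>\<^sub>0 nat) \<Rightarrow>\<^sub>0 real"

definition mpolys :: "nat \<Rightarrow> real_mpoly set" where
  "mpolys n = {P. \<forall>m\<in>Poly_Mapping.keys P. Poly_Mapping.keys m \<subseteq> {1..n}}"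

definition eval_mpoly :: "real_mpoly \<Rightarrow> (nat \<Rightarrow> real) \<Rightarrow> real" where
  "eval_mpoly P a =
     (\<Sum>m\<in>Poly_Mapping.keys P. Poly_Mapping.lookup P m *
        (\<Prod>i\<in>Poly_Mapping.keys m. a i ^ Poly_Mapping.lookup m i))"

definition poly_cylindrical ::
  "'i::order set \<Rightarrow> ('i \<Rightarrow> 'e set) \<Rightarrow> ('i \<Rightarrow> 'e manifold) \<Rightarrow> ('i \<Rightarrow> 'i \<Rightarrow> 'e \<Rightarrow> 'e) \<Rightarrow>
   ('i \<Rightarrow> 'i \<Rightarrow> 'e \<Rightarrow> 'e) \<Rightarrow> (('i \<Rightarrow> 'e) \<Rightarrow> real) set" where
  "poly_cylindrical A E M \<pi> \<iota> =
     (\<Union>n\<in>{1..}. {\<lambda>x\<in>product_limit A E \<pi>. eval_mpoly P (\<lambda>i. f i x) | P f.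
                    P \<in> mpolys n \<and> (\<forall>i\<in>{1..n}. f i \<in> Cyl_on_limit A E M \<pi> \<iota>)})"


section \<open>Distances\<close>

definition dist_infty :: "'i set \<Rightarrow> ('i \<Rightarrow> 'e \<Rightarrow> 'e \<Rightarrow> real) \<Rightarrow> ('i \<Rightarrow> 'e) \<Rightarrow> ('i \<Rightarrow> 'e) \<Rightarrow> real" where
  "dist_infty A d x y = (SUP J\<in>A. d J (x J) (y J) / (1 + d J (x J) (y J)))"

definition limit_topology ::
  "'i::order set \<Rightarrow> ('i \<Rightarrow> 'e set) \<Rightarrow> ('i \<Rightarrow> 'i \<Rightarrow> 'e \<Rightarrow> 'e) \<Rightarrow> ('i \<Rightarrow> 'e \<Rightarrow> 'e \<Rightarrow> real) \<Rightarrow>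
   ('i \<Rightarrow> 'e) topology" where
  "limit_topology A E \<pi> d = Metric_space.mtopology (product_limit A E \<pi>) (dist_infty A d)"

text \<open>
  The uniform distance on the bounded continuous real functions on \<open>X\<close>; for compact \<open>X\<close> these are
  all the continuous real functions. The closure operator intersects its argument with this space
  first, so \<open>uniform_topology X closure_of D = topspace (uniform_topology X)\<close> says that the continuous
  members of \<open>D\<close> are uniformly dense in \<open>C\<^sup>0(X, \<real>)\<close>.
\<close>

definition uniform_topology :: "'a topology \<Rightarrow> ('a \<Rightarrow> real) topology" where
  "uniform_topology X = mtopology_of (cfunspace X euclidean_metric)"

end

theory Submission
  imports Defs
begin

text \<open>
  Already the cylindrical functions that depend on a single coordinate are dense; they are values of
  the polynomial \<open>X\<^sub>1\<close>. Consider the functions on the product limit that are continuous, smooth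
  along plots, and depend on one coordinate \<open>x J\<close> only. Each of them is cylindrical: \<open>J\<close> lies in some
  maximal antichain of \<open>A\<close>, which is a section, and the projection along this section keeps the
  coordinate \<open>J\<close> (\<open>restrict_coordinate_function_in_Cyl\<close>).

  They form an algebra, because \<open>A\<close> is directed: a function of \<open>x I\<close> and a function of \<open>x J\<close> are both
  functions of \<open>x K\<close> as soon as \<open>I \<le> K\<close> and \<open>J \<le> K\<close>, since the projections recover \<open>x I\<close> and \<open>x J\<close>
  from \<open>x K\<close> (\<open>coordinate_functions_combine\<close>). And they separate points: two different points of the
  limit differ in some coordinate \<open>J\<close>, the manifold \<open>E J\<close> carries a smooth bump function that separates
  the two values there (\<open>smooth_function_separates_points\<close>), and the coordinate map to \<open>E J\<close> is
  continuous for the supremum distance (\<open>continuous_map_dist_infty_coordinate\<close>).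

  Hence the Stone--Weierstrass theorem on the compact limit applies. The limit is a topology on a set,
  not a topological type; the theorem reaches it through an embedding into a power of the reals
  (\<open>Stone_Weierstrass_topology\<close>).
\<close>

section \<open>Smoothness on open subsets of Euclidean space\<close>

lemma eventually_coordinate_update:
  assumes "openin (Euclidean_space n) U" "x \<in> U" "i < n"
  shows "\<forall>\<^sub>F t in nhds (x i). x(i := t) \<in> U"
proof -
  have x: "x \<in> topspace (Euclidean_space n)"
    using assms openin_subset by blast
  have "continuous_map euclideanreal euclideanreal (\<lambda>t. (x(i := t)) j)" for j
    by (cases "j = i") auto
  then have "continuous_map euclideanreal (Euclidean_space n) (\<lambda>t. x(i := t))"
    using x \<open>i < n\<close>
    by (auto simp: Euclidean_space_def continuous_map_in_subtopology
        continuous_map_componentwise_UNIV)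
  then have "openin euclideanreal {t \<in> topspace euclideanreal. x(i := t) \<in> U}"
    using assms(1) by (rule openin_continuous_map_preimage)
  then have "open {t. x(i := t) \<in> U}"
    by simp
  then show ?thesis
    using \<open>x \<in> U\<close> by (auto simp: eventually_nhds intro!: exI[of _ "{t. x(i := t) \<in> U}"])
qed

lemma continuous_map_open_cover2:
  assumes "openin X S" "openin X T" "topspace X \<subseteq> S \<union> T"
    and "continuous_map (subtopology X S) Y f" "continuous_map (subtopology X T) Y f"
  shows "continuous_map X Y f"
  by (rule pasting_lemma[where I = "UNIV :: bool set" and T = "\<lambda>b. if b then S else T"
        and f = "\<lambda>_. f"]) (use assms in auto)

lemma Ck_on_imp_continuous_map:
  "Ck_on n k U f \<Longrightarrow> continuous_map (subtopology (Euclidean_space n) U) euclideanreal f"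
  by (cases k) auto

text \<open>
  The functions compared agree on a neighbourhood of each point, but not outside \<open>U\<close>; this is
  where the openness of \<open>U\<close> matters, since a partial derivative in \<^const>\<open>Ck_on\<close> is taken of the
  total function.
\<close>

lemma Ck_on_cong_imp:
  assumes U: "openin (Euclidean_space n) U"
  shows "Ck_on n k U f \<Longrightarrow> (\<And>x. x \<in> U \<Longrightarrow> f x = g x) \<Longrightarrow> Ck_on n k U g"
proof (induction k arbitrary: f g)
  case 0
  then show ?case
    by (auto elim!: continuous_map_eq)
next
  case (Suc k)
  have ev: "\<forall>\<^sub>F t in nhds (x i). f (x(i := t)) = g (x(i := t))" if "x \<in> U" "i < n" for x i
    using eventually_coordinate_update[OF U that] by eventually_elim (use Suc.prems(2) in auto)
  have "Ck_on n k U (partial_deriv i g)" if "i < n" for i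
  proof (rule Suc.IH)
    show "Ck_on n k U (partial_deriv i f)"
      using Suc.prems(1) that by simp
    show "partial_deriv i f x = partial_deriv i g x" if "x \<in> U" for x
      unfolding partial_deriv_def by (rule deriv_cong_ev[OF ev]) (use that \<open>i < n\<close> in auto)
  qed
  moreover have "(\<lambda>t. g (x(i := t))) differentiable (at (x i))" if "i < n" "x \<in> U" for i x
  proof -
    have "(\<lambda>t. f (x(i := t))) differentiable (at (x i))"
      using Suc.prems(1) that by simp
    then show ?thesis
      using DERIV_cong_ev[OF refl ev[OF that(2,1)] refl]
      unfolding real_differentiable_def by simp
  qed
  moreover have "continuous_map (subtopology (Euclidean_space n) U) euclideanreal g"
    using Suc.prems by (auto elim!: continuous_map_eq)
  ultimately show ?case
    by simp
qed

text \<open>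
  A version of the recursion in which the partial derivatives are only required on \<open>U\<close>. Closure
  under sums, products and composition is an induction with this rule, fed with the usual
  differentiation rules.
\<close>

lemma Ck_on_Suc_iff:
  assumes U: "openin (Euclidean_space n) U"
  shows "Ck_on n (Suc k) U f \<longleftrightarrow>
    continuous_map (subtopology (Euclidean_space n) U) euclideanreal f \<and>
    (\<forall>i<n. \<exists>g. Ck_on n k U g \<and>
       (\<forall>x\<in>U. ((\<lambda>t. f (x(i := t))) has_real_derivative g x) (at (x i))))"
    (is "?L \<longleftrightarrow> ?R")
proof
  assume ?L
  then show ?R
    by (auto simp: partial_deriv_def DERIV_deriv_iff_real_differentiable
        intro!: exI[of _ "partial_deriv _ f"])
next
  assume R: ?R
  have "Ck_on n k U (partial_deriv i f)
        \<and> (\<forall>x\<in>U. (\<lambda>t. f (x(i := t))) differentiable (at (x i)))" if "i < n" for i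
  proof -
    obtain g where g: "Ck_on n k U g"
      "\<And>x. x \<in> U \<Longrightarrow> ((\<lambda>t. f (x(i := t))) has_real_derivative g x) (at (x i))"
      using R \<open>i < n\<close> by blast
    have "Ck_on n k U (partial_deriv i f)"
      by (rule Ck_on_cong_imp[OF U g(1)]) (simp add: partial_deriv_def DERIV_imp_deriv[OF g(2)])
    then show ?thesis
      using g(2) real_differentiable_def by blast
  qed
  then show ?L
    using R by simp
qed

lemma Ck_on_SucD: "Ck_on n (Suc k) U f \<Longrightarrow> Ck_on n k U f"
proof (induction k arbitrary: f)
  case (Suc k)
  have "Ck_on n (Suc k) U (partial_deriv i f)"
    "\<forall>x\<in>U. (\<lambda>t. f (x(i := t))) differentiable (at (x i))" if "i < n" for i
    using Suc.prems that by auto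
  then show ?case
    using Suc.IH Ck_on_imp_continuous_map[OF Suc.prems] by (subst Ck_on.simps) blast
qed simp

lemma Ck_on_const:
  assumes U: "openin (Euclidean_space n) U"
  shows "Ck_on n k U (\<lambda>_. c)"
proof (induction k arbitrary: c)
  case (Suc k)
  then show ?case
    unfolding Ck_on_Suc_iff[OF U] by (auto intro!: exI[of _ "\<lambda>_. 0"])
qed simp

lemma Ck_on_add:
  assumes U: "openin (Euclidean_space n) U"
  shows "Ck_on n k U f \<Longrightarrow> Ck_on n k U g \<Longrightarrow> Ck_on n k U (\<lambda>x. f x + g x)"
proof (induction k arbitrary: f g)
  case 0
  then show ?case
    by (auto intro: continuous_map_add)
next
  case (Suc k)
  note fg = Suc.prems[unfolded Ck_on_Suc_iff[OF U]]
  show ?case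
    unfolding Ck_on_Suc_iff[OF U]
  proof (intro conjI allI impI)
    show "continuous_map (subtopology (Euclidean_space n) U) euclideanreal (\<lambda>x. f x + g x)"
      using fg by (auto intro: continuous_map_add)
    fix i assume "i < n"
    then obtain f' g' where "Ck_on n k U f'" "Ck_on n k U g'"
      and "\<forall>x\<in>U. ((\<lambda>t. f (x(i := t))) has_real_derivative f' x) (at (x i))"
      and "\<forall>x\<in>U. ((\<lambda>t. g (x(i := t))) has_real_derivative g' x) (at (x i))"
      using fg by meson
    then show "\<exists>h. Ck_on n k U h \<and>
        (\<forall>x\<in>U. ((\<lambda>t. f (x(i := t)) + g (x(i := t))) has_real_derivative h x) (at (x i)))"
      using Suc.IH by (intro exI[of _ "\<lambda>x. f' x + g' x"]) (auto intro: DERIV_add)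
  qed
qed

lemma Ck_on_mult:
  assumes U: "openin (Euclidean_space n) U"
  shows "Ck_on n k U f \<Longrightarrow> Ck_on n k U g \<Longrightarrow> Ck_on n k U (\<lambda>x. f x * g x)"
proof (induction k arbitrary: f g)
  case 0
  then show ?case
    by (auto intro: continuous_map_real_mult)
next
  case (Suc k)
  note fg = Suc.prems[unfolded Ck_on_Suc_iff[OF U]]
  show ?case
    unfolding Ck_on_Suc_iff[OF U]
  proof (intro conjI allI impI)
    show "continuous_map (subtopology (Euclidean_space n) U) euclideanreal (\<lambda>x. f x * g x)"
      using fg by (auto intro: continuous_map_real_mult)
    fix i assume "i < n"
    then obtain f' g' where f'g': "Ck_on n k U f'" "Ck_on n k U g'"
      and df: "\<forall>x\<in>U. ((\<lambda>t. f (x(i := t))) has_real_derivative f' x) (at (x i))"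
      and dg: "\<forall>x\<in>U. ((\<lambda>t. g (x(i := t))) has_real_derivative g' x) (at (x i))"
      using fg by meson
    have "Ck_on n k U (\<lambda>x. f' x * g x + g' x * f x)"
      using f'g' Suc.prems[THEN Ck_on_SucD] by (intro Ck_on_add[OF U] Suc.IH)
    moreover have "((\<lambda>t. f (x(i := t)) * g (x(i := t))) has_real_derivative
        f' x * g x + g' x * f x) (at (x i))" if "x \<in> U" for x
      using DERIV_mult[OF df[rule_format, OF that] dg[rule_format, OF that]] by simp
    ultimately show "\<exists>h. Ck_on n k U h \<and>
        (\<forall>x\<in>U. ((\<lambda>t. f (x(i := t)) * g (x(i := t))) has_real_derivative h x) (at (x i)))"
      by blast
  qed
qed

lemma Ck_on_sum:
  assumes "openin (Euclidean_space n) U" "finite I" "\<And>i. i \<in> I \<Longrightarrow> Ck_on n k U (f i)"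
  shows "Ck_on n k U (\<lambda>x. \<Sum>i\<in>I. f i x)"
  using assms(2,3)
  by (induction I rule: finite_induct) (auto simp: Ck_on_const Ck_on_add assms(1))

text \<open>A smooth function of one variable is given here by the sequence of its derivatives.\<close>

lemma Ck_on_compose:
  fixes h :: "nat \<Rightarrow> real \<Rightarrow> real"
  assumes U: "openin (Euclidean_space n) U"
    and h: "\<And>j t. (h j has_real_derivative h (Suc j) t) (at t)"
  shows "Ck_on n k U f \<Longrightarrow> Ck_on n k U (\<lambda>x. h j (f x))"
proof (induction k arbitrary: j)
  have cont: "continuous_map (subtopology (Euclidean_space n) U) euclideanreal (\<lambda>x. h j (f x))"
    if "continuous_map (subtopology (Euclidean_space n) U) euclideanreal f" for j
  proof -
    have "continuous_map euclideanreal euclideanreal (h j)"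
      by (auto intro: DERIV_continuous_on h)
    from continuous_map_compose[OF that this] show ?thesis
      by (simp add: o_def)
  qed
  {
    case 0
    then show ?case
      by (simp add: cont)
  next
    case (Suc k)
    note f = Suc.prems[unfolded Ck_on_Suc_iff[OF U]]
    show ?case
      unfolding Ck_on_Suc_iff[OF U]
    proof (intro conjI allI impI)
      show "continuous_map (subtopology (Euclidean_space n) U) euclideanreal (\<lambda>x. h j (f x))"
        using f by (simp add: cont)
      fix i assume "i < n"
      then obtain f' where f': "Ck_on n k U f'"
        and df: "\<forall>x\<in>U. ((\<lambda>t. f (x(i := t))) has_real_derivative f' x) (at (x i))"
        using conjunct2[OF f, rule_format, OF \<open>i < n\<close>] by blast
      have "Ck_on n k U (\<lambda>x. h (Suc j) (f x) * f' x)"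
        using f' Suc.prems[THEN Ck_on_SucD] by (intro Ck_on_mult[OF U] Suc.IH)
      moreover have "((\<lambda>t. h j (f (x(i := t)))) has_real_derivative h (Suc j) (f x) * f' x)
          (at (x i))" if "x \<in> U" for x
        using DERIV_chain2[OF h df[rule_format, OF that]] by simp
      ultimately show "\<exists>g. Ck_on n k U g \<and>
          (\<forall>x\<in>U. ((\<lambda>t. h j (f (x(i := t)))) has_real_derivative g x) (at (x i)))"
        by blast
    qed
  }
qed

lemma Ck_on_Un:
  assumes U: "openin (Euclidean_space n) U" and V: "openin (Euclidean_space n) V"
  shows "Ck_on n k U f \<Longrightarrow> Ck_on n k V f \<Longrightarrow> Ck_on n k (U \<union> V) f"
proof (induction k arbitrary: f)
  have cont: "continuous_map (subtopology (Euclidean_space n) (U \<union> V)) euclideanreal f"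
    if "continuous_map (subtopology (Euclidean_space n) U) euclideanreal f"
      "continuous_map (subtopology (Euclidean_space n) V) euclideanreal f" for f
  proof (rule continuous_map_open_cover2[where S = U and T = V])
    show "openin (subtopology (Euclidean_space n) (U \<union> V)) U"
      "openin (subtopology (Euclidean_space n) (U \<union> V)) V"
      using U V openin_open_subtopology[OF openin_Un[OF U V]] by auto
    have "(U \<union> V) \<inter> U = U" "(U \<union> V) \<inter> V = V"
      by auto
    then show "continuous_map (subtopology (subtopology (Euclidean_space n) (U \<union> V)) U) euclideanreal f"
      "continuous_map (subtopology (subtopology (Euclidean_space n) (U \<union> V)) V) euclideanreal f"
      using that by (simp_all add: subtopology_subtopology)
  qed auto
  {
    case 0
    then show ?case
      by (simp add: cont)
  next
    case (Suc k)
    then show ?case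
      by (auto intro!: cont)
  }
qed

section \<open>A flat function\<close>

text \<open>
  For \<open>P = 1\<close> this is the classical smooth function that is positive exactly on the positive
  half-line. The polynomial factor is there to make the family closed under differentiation.
\<close>

definition flat_fun :: "real poly \<Rightarrow> real \<Rightarrow> real" where
  "flat_fun P t = (if t > 0 then poly P (1 / t) * exp (- (1 / t)) else 0)"

lemma flat_fun_0: "flat_fun P 0 = 0"
  by (simp add: flat_fun_def)

lemma poly_times_exp_minus_tendsto_0:
  fixes P :: "real poly"
  shows "((\<lambda>s. poly P s * exp (- s)) \<longlongrightarrow> 0) at_top"
proof -
  have "((\<lambda>s. \<Sum>i\<le>degree P. coeff P i * (s ^ i / exp s)) \<longlongrightarrow> (\<Sum>i\<le>degree P. coeff P i * 0)) at_top"
    by (intro tendsto_sum tendsto_mult tendsto_const tendsto_power_div_exp_0)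
  then show ?thesis
    by (simp add: poly_altdef sum_distrib_right exp_minus divide_inverse mult.assoc)
qed

lemma flat_fun_at_right_0: "(flat_fun P \<longlongrightarrow> 0) (at_right 0)"
proof -
  have "((\<lambda>t. poly P (inverse t) * exp (- inverse t)) \<longlongrightarrow> 0) (at_right 0)"
    using poly_times_exp_minus_tendsto_0[of P] unfolding filterlim_at_top_to_right by simp
  moreover have "\<forall>\<^sub>F t in at_right 0. poly P (inverse t) * exp (- inverse t) = flat_fun P t"
    by (auto simp: flat_fun_def eventually_at_filter inverse_eq_divide)
  ultimately show ?thesis
    by (rule Lim_transform_eventually)
qed

lemma has_derivative_flat_fun:
  "(flat_fun P has_real_derivative flat_fun ([:0, 0, 1:] * (P - pderiv P)) t) (at t)"
proof -
  consider "t < 0" | "t = 0" | "t > 0"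
    by linarith
  then show ?thesis
  proof cases
    case 1
    then have "\<forall>\<^sub>F s in nhds t. s < 0"
      using eventually_nhds_in_open[of "{..<0}" t] by simp
    then have "\<forall>\<^sub>F s in nhds t. flat_fun P s = 0"
      by eventually_elim (simp add: flat_fun_def)
    then have "(flat_fun P has_real_derivative 0) (at t) \<longleftrightarrow> ((\<lambda>_. 0) has_real_derivative 0) (at t)"
      by (intro DERIV_cong_ev) auto
    then show ?thesis
      using 1 by (simp add: flat_fun_def)
  next
    case 2
    \<comment> \<open>The difference quotient at 0 is again a flat function, for the polynomial \<open>X P\<close>.\<close>
    have quot: "flat_fun P s / s = flat_fun (pCons 0 P) s" for s
      by (simp add: flat_fun_def)
    have "(flat_fun (pCons 0 P) \<longlongrightarrow> 0) (at_left 0)"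
      by (rule tendsto_eventually) (auto simp: flat_fun_def eventually_at_filter)
    then have "(flat_fun (pCons 0 P) \<longlongrightarrow> 0) (at 0)"
      using flat_fun_at_right_0 by (simp add: filterlim_split_at)
    then show ?thesis
      using 2 by (simp add: DERIV_def quot flat_fun_0)
  next
    case 3
    then have "\<forall>\<^sub>F s in nhds t. 0 < s"
      using eventually_nhds_in_open[of "{0<..}" t] by simp
    then have "\<forall>\<^sub>F s in nhds t. flat_fun P s = poly P (1 / s) * exp (- (1 / s))"
      by eventually_elim (simp add: flat_fun_def)
    then have "(flat_fun P has_real_derivative D) (at t)
      \<longleftrightarrow> ((\<lambda>s. poly P (1 / s) * exp (- (1 / s))) has_real_derivative D) (at t)" for D
      by (intro DERIV_cong_ev) auto
    moreover have "((\<lambda>s. poly P (1 / s) * exp (- (1 / s))) has_real_derivative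
        flat_fun ([:0, 0, 1:] * (P - pderiv P)) t) (at t)"
      using 3
      by (auto simp: flat_fun_def field_simps power2_eq_square
          intro!: derivative_eq_intros DERIV_chain2[OF poly_DERIV])
    ultimately show ?thesis
      by simp
  qed
qed

lemma Ck_on_flat_fun:
  assumes "openin (Euclidean_space n) U" "Ck_on n k U f"
  shows "Ck_on n k U (\<lambda>x. flat_fun P (f x))"
proof -
  define h where "h j = flat_fun (((\<lambda>Q. [:0, 0, 1:] * (Q - pderiv Q)) ^^ j) P)" for j
  have "(h j has_real_derivative h (Suc j) t) (at t)" for j t
    using has_derivative_flat_fun[of "((\<lambda>Q. [:0, 0, 1:] * (Q - pderiv Q)) ^^ j) P" t]
    by (simp add: h_def)
  from Ck_on_compose[of n U h, OF assms(1) this assms(2), of 0] show ?thesis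
    by (simp add: h_def)
qed

section \<open>Smooth functions separate the points of a manifold\<close>

lemma compact_box_in_open:
  assumes W: "openin (Euclidean_space n) W" and a: "a \<in> W"
  obtains r where "0 < r"
    and "compactin (Euclidean_space n)
           {u \<in> topspace (Euclidean_space n). \<forall>i<n. \<bar>u i - a i\<bar> \<le> r}"
    and "{u \<in> topspace (Euclidean_space n). \<forall>i<n. \<bar>u i - a i\<bar> \<le> r} \<subseteq> W"
proof -
  have a0: "a i = 0" if "n \<le> i" for i
    using openin_subset[OF W] a that by (auto simp: topspace_Euclidean_space)
  obtain T where T: "openin (powertop_real UNIV) T" and WT: "W = T \<inter> {x. \<forall>i\<ge>n. x i = 0}"
    using W by (auto simp: Euclidean_space_def openin_subtopology)
  obtain V where V: "\<And>i. open (V i)" "\<And>i. a i \<in> V i" "Pi\<^sub>E UNIV V \<subseteq> T"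
    using T[unfolded openin_product_topology_alt, rule_format, of a] a WT by (auto simp: PiE_iff)
  have "\<exists>e>0. cball (a i) e \<subseteq> V i" for i
    using V(1,2) open_contains_cball by blast
  then obtain e where e: "\<And>i. 0 < e i" "\<And>i. cball (a i) (e i) \<subseteq> V i"
    by metis
  \<comment> \<open>The 1 keeps the minimum meaningful in dimension 0.\<close>
  define r where "r = Min (insert 1 (e ` {..<n}))"
  have "0 < r"
    using e(1) by (simp add: r_def)
  have r_le: "r \<le> e i" if "i < n" for i
    using that by (auto simp: r_def)
  let ?B = "{u \<in> topspace (Euclidean_space n). \<forall>i<n. \<bar>u i - a i\<bar> \<le> r}"
  show thesis
  proof (rule that[OF \<open>0 < r\<close>])
    define S where "S i = (if i < n then {a i - r .. a i + r} else {0})" for i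
    have S_eq: "?B = {u. \<forall>i. u i \<in> S i}"
    proof (rule set_eqI, unfold mem_Collect_eq, rule iffI)
      fix u assume u: "u \<in> topspace (Euclidean_space n) \<and> (\<forall>i<n. \<bar>u i - a i\<bar> \<le> r)"
      show "\<forall>i. u i \<in> S i"
      proof
        fix i
        have "\<bar>u i - a i\<bar> \<le> r" if "i < n"
          using u that by blast
        moreover have "u i = 0" if "n \<le> i"
          using u that by (simp add: topspace_Euclidean_space)
        ultimately show "u i \<in> S i"
          by (cases "i < n") (auto simp: S_def)
      qed
    next
      fix u assume u: "\<forall>i. u i \<in> S i"
      have "\<bar>u i - a i\<bar> \<le> r" if "i < n" for i
        using u[rule_format, of i] that by (simp add: S_def abs_le_iff)
      moreover have "u i = 0" if "n \<le> i" for i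
        using u[rule_format, of i] that by (simp add: S_def)
      ultimately show "u \<in> topspace (Euclidean_space n) \<and> (\<forall>i<n. \<bar>u i - a i\<bar> \<le> r)"
        by (simp add: topspace_Euclidean_space)
    qed
    have "compactin (powertop_real UNIV) (Pi\<^sub>E UNIV S)"
      unfolding compactin_PiE by (simp add: S_def)
    then have "compactin (powertop_real UNIV) ?B"
      unfolding S_eq by (simp add: PiE_def Pi_def)
    moreover have "?B \<subseteq> {x. \<forall>i\<ge>n. x i = 0}"
      by (auto simp: topspace_Euclidean_space)
    ultimately show "compactin (Euclidean_space n) ?B"
      unfolding Euclidean_space_def compactin_subtopology by simp
    have "u i \<in> V i" if "u \<in> ?B" for u i
    proof (cases "i < n")
      case True
      then have "u i \<in> cball (a i) (e i)"
        using that r_le[OF True] by (force simp: dist_real_def abs_minus_commute)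
      then show ?thesis
        using e(2) by blast
    next
      case False
      then have "u i = a i"
        using that a0 by (auto simp: topspace_Euclidean_space)
      then show ?thesis
        using V(2) by simp
    qed
    then show "?B \<subseteq> W"
      using V(3) WT by (auto simp: topspace_Euclidean_space)
  qed
qed

text \<open>
  Smoothness of a real function on a manifold is expressed through smooth parametrisations instead
  of charts, because plots of a limit are families of such parametrisations.
\<close>

definition smooth_on_params :: "'e manifold \<Rightarrow> ('e \<Rightarrow> real) \<Rightarrow> bool" where
  "smooth_on_params M g \<longleftrightarrow>
     (\<forall>n U p. openin (Euclidean_space n) U \<longrightarrow> smooth_param n U M p \<longrightarrow>
        smooth_real_on n U (\<lambda>u. g (p u)))"

text \<open>
  In a chart \<open>\<phi>\<close> around \<open>x\<close>, take a box of radius \<open>r\<close> around \<open>\<phi> x\<close> that lies in the image of the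
  chart domain without \<open>y\<close>. With \<open>\<rho> e\<close> denoting \<open>r\<^sup>2\<close> minus the square of the Euclidean distance of
  \<open>\<phi> e\<close> and \<open>\<phi> x\<close>, the separating function is \<open>exp (- 1 / \<rho> e)\<close> where \<open>e\<close> is in the chart domain and
  \<open>\<rho> e > 0\<close>, and 0 elsewhere. It vanishes off the preimage \<open>K\<close> of the box. As \<open>K\<close> is compact, it is
  closed in the manifold, which is Hausdorff. So the manifold is the union of two open sets: the
  chart domain, where the function is a smooth expression in the coordinates, and the complement of
  \<open>K\<close>, where it is 0.
\<close>

lemma smooth_function_separates_points:
  assumes M: "smooth_manifold M" and x: "x \<in> topspace (mtop M)" and y: "y \<in> topspace (mtop M)"
    and "x \<noteq> y"
  obtains g where "continuous_map (mtop M) euclideanreal g" "smooth_on_params M g" "g x \<noteq> g y"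
proof -
  let ?X = "mtop M" and ?n = "mdim M"
  have Haus: "Hausdorff_space ?X"
    using M by (simp add: smooth_manifold_def)
  obtain V \<phi> where V\<phi>: "(V, \<phi>) \<in> atlas M" and xV: "x \<in> V"
    using M x unfolding smooth_manifold_def by blast
  have "is_chart ?X ?n V \<phi>"
    using M V\<phi> by (auto simp: smooth_manifold_def)
  then have V: "openin ?X V" and \<phi>V: "openin (Euclidean_space ?n) (\<phi> ` V)"
    and hom: "homeomorphic_map (subtopology ?X V) (subtopology (Euclidean_space ?n) (\<phi> ` V)) \<phi>"
    by (auto simp: is_chart_def)
  have VX: "V \<subseteq> topspace ?X" and \<phi>VE: "\<phi> ` V \<subseteq> topspace (Euclidean_space ?n)"
    using V \<phi>V by (auto dest: openin_subset)
  have topV: "topspace (subtopology ?X V) = V"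
    using VX by auto
  have inj: "inj_on \<phi> V"
    using homeomorphic_imp_injective_map[OF hom] topV by simp

  have "openin ?X (V - {y})"
    using V Haus y by (simp add: openin_diff closedin_Hausdorff_singleton)
  then have "openin (subtopology ?X V) (V - {y})"
    using V by (simp add: openin_open_subtopology Diff_subset)
  then have "openin (subtopology (Euclidean_space ?n) (\<phi> ` V)) (\<phi> ` (V - {y}))"
    using homeomorphic_map_openness[OF hom, of "V - {y}"] topV by auto
  then have "openin (Euclidean_space ?n) (\<phi> ` (V - {y}))"
    using \<phi>V openin_trans_full by blast
  moreover have "\<phi> x \<in> \<phi> ` (V - {y})"
    using xV \<open>x \<noteq> y\<close> by blast
  ultimately obtain r where "0 < r"
    and r: "compactin (Euclidean_space ?n)
          {u \<in> topspace (Euclidean_space ?n). \<forall>i<?n. \<bar>u i - \<phi> x i\<bar> \<le> r}"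
        "{u \<in> topspace (Euclidean_space ?n). \<forall>i<?n. \<bar>u i - \<phi> x i\<bar> \<le> r} \<subseteq> \<phi> ` (V - {y})"
    by (rule compact_box_in_open)
  define B where "B = {u \<in> topspace (Euclidean_space ?n). \<forall>i<?n. \<bar>u i - \<phi> x i\<bar> \<le> r}"
  note B = r(1)[folded B_def] and BV = r(2)[folded B_def]

  define K where "K = {e \<in> V. \<phi> e \<in> B}"
  have "\<phi> ` K = B"
    unfolding K_def using BV by blast
  moreover have "compactin (subtopology (Euclidean_space ?n) (\<phi> ` V)) B"
    using B BV by (auto simp: compactin_subtopology)
  ultimately have "compactin (subtopology ?X V) K"
    using homeomorphic_map_compactness[OF hom, of K] topV K_def by auto
  then have "compactin ?X K"
    by (simp add: compactin_subtopology)
  then have K: "closedin ?X K"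
    using Haus compactin_imp_closedin by blast
  have "y \<notin> K"
  proof
    assume "y \<in> K"
    then have "y \<in> V" "\<phi> y \<in> \<phi> ` (V - {y})"
      using BV by (auto simp: K_def)
    then show False
      using inj by (auto simp: inj_on_def)
  qed

  define \<rho> where "\<rho> e = r\<^sup>2 - (\<Sum>i<?n. (\<phi> e i - \<phi> x i)\<^sup>2)" for e
  define g where "g e = (if e \<in> V then flat_fun 1 (\<rho> e) else 0)" for e
  have g_zero: "g e = 0" if eK: "e \<notin> K" for e
  proof (cases "e \<in> V")
    case True
    then have "\<phi> e \<in> topspace (Euclidean_space ?n)" "\<phi> e \<notin> B"
      using eK \<phi>VE by (auto simp: K_def)
    then obtain i where i: "i < ?n" "r < \<bar>\<phi> e i - \<phi> x i\<bar>"
      by (auto simp: B_def not_le)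
    have "r\<^sup>2 \<le> (\<phi> e i - \<phi> x i)\<^sup>2"
      using i \<open>0 < r\<close> abs_le_square_iff[of r "\<phi> e i - \<phi> x i"] by simp
    also have "\<dots> \<le> (\<Sum>i<?n. (\<phi> e i - \<phi> x i)\<^sup>2)"
      using i(1) by (intro member_le_sum) auto
    finally show ?thesis
      by (simp add: g_def \<rho>_def flat_fun_def)
  qed (simp add: g_def)

  show thesis
  proof (rule that)
    have "\<rho> x = r\<^sup>2"
      by (simp add: \<rho>_def)
    then have "g x > 0"
      using xV \<open>0 < r\<close> by (simp add: g_def flat_fun_def)
    then show "g x \<noteq> g y"
      using g_zero[OF \<open>y \<notin> K\<close>] by simp

    have cover: "topspace ?X \<subseteq> V \<union> (topspace ?X - K)"
      by (auto simp: K_def)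
    have "continuous_map (subtopology ?X V) (Euclidean_space ?n) \<phi>"
      using homeomorphic_imp_continuous_map[OF hom] by (simp add: continuous_map_in_subtopology)
    then have coord: "continuous_map (subtopology ?X V) euclideanreal (\<lambda>e. \<phi> e i)" for i
      by (simp add: Euclidean_space_def continuous_map_in_subtopology continuous_map_componentwise_UNIV)
    have "continuous_map (subtopology ?X V) euclideanreal \<rho>"
      unfolding \<rho>_def
      by (intro continuous_map_diff continuous_map_sum continuous_map_real_pow
          continuous_map_canonical_const coord) auto
    moreover have "continuous_map euclideanreal euclideanreal (flat_fun 1)"
      by (auto intro: DERIV_continuous_on has_derivative_flat_fun)
    ultimately have "continuous_map (subtopology ?X V) euclideanreal (flat_fun 1 \<circ> \<rho>)"
      by (rule continuous_map_compose)
    then have "continuous_map (subtopology ?X V) euclideanreal g"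
      by (rule continuous_map_eq) (simp add: g_def)
    moreover have "continuous_map (subtopology ?X (topspace ?X - K)) euclideanreal g"
      by (rule continuous_map_eq[of _ _ "\<lambda>_. 0"]) (auto simp: g_zero)
    ultimately show "continuous_map ?X euclideanreal g"
      using continuous_map_open_cover2[OF V _ cover] K by blast

    show "smooth_on_params M g"
      unfolding smooth_on_params_def smooth_real_on_def
    proof (intro allI impI)
      fix n U p k
      assume U: "openin (Euclidean_space n) U" and p: "smooth_param n U M p"
      have cont_p: "continuous_map (subtopology (Euclidean_space n) U) ?X p"
        using p by (simp add: smooth_param_def)
      have topU: "topspace (subtopology (Euclidean_space n) U) = U"
        using openin_subset[OF U] by auto
      have pre: "openin (Euclidean_space n) {u \<in> U. p u \<in> W}" if "openin ?X W" for W
        using openin_continuous_map_preimage[OF cont_p that] topU U openin_trans_full by metis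
      note U1 = pre[OF V] and U2 = pre[OF openin_diff[OF openin_topspace K]]
      have "Ck_on n k {u \<in> U. p u \<in> V} (\<lambda>u. \<phi> (p u) i)" if "i < ?n" for i
        using p V\<phi> that unfolding smooth_param_def smooth_real_on_def by blast
      then have "Ck_on n k {u \<in> U. p u \<in> V}
          (\<lambda>u. r\<^sup>2 + (-1) * (\<Sum>i<?n. (\<phi> (p u) i + - \<phi> x i) * (\<phi> (p u) i + - \<phi> x i)))"
        by (intro Ck_on_add Ck_on_mult Ck_on_sum Ck_on_const U1) auto
      then have "Ck_on n k {u \<in> U. p u \<in> V} (\<lambda>u. \<rho> (p u))"
        by (simp add: \<rho>_def power2_eq_square)
      then have "Ck_on n k {u \<in> U. p u \<in> V} (\<lambda>u. flat_fun 1 (\<rho> (p u)))"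
        by (rule Ck_on_flat_fun[OF U1])
      then have 1: "Ck_on n k {u \<in> U. p u \<in> V} (\<lambda>u. g (p u))"
        by (rule Ck_on_cong_imp[OF U1]) (simp add: g_def)
      have 2: "Ck_on n k {u \<in> U. p u \<in> topspace ?X - K} (\<lambda>u. g (p u))"
        by (rule Ck_on_cong_imp[OF U2 Ck_on_const[OF U2, of k 0]]) (simp add: g_zero)
      have "p u \<in> topspace ?X" if "u \<in> U" for u
        using continuous_map_funspace[OF cont_p] that topU by auto
      then have "{u \<in> U. p u \<in> V} \<union> {u \<in> U. p u \<in> topspace ?X - K} = U"
        by (auto simp: K_def)
      then show "Ck_on n k U (\<lambda>u. g (p u))"
        using Ck_on_Un[OF U1 U2 1 2] by simp
    qed
  qed
qed

section \<open>The Stone--Weierstrass theorem for abstract topologies\<close>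

text \<open>
  Function types are Hausdorff when their codomain is. The two weaker separation axioms need instances
  of their own, so that the inferred ones for metrizable function types remain special cases.
\<close>

lemma open_coordinate_preimage:
  fixes W :: "'b::topological_space set"
  assumes "open W"
  shows "open {h :: 'a \<Rightarrow> 'b. h i \<in> W}"
  using open_vimage[OF assms continuous_on_product_coordinates[of i]] by (simp add: vimage_def)

instance "fun" :: (type, t0_space) t0_space
proof
  fix f g :: "'a \<Rightarrow> 'b"
  assume "f \<noteq> g"
  then obtain i where "f i \<noteq> g i"
    by (meson ext)
  then obtain W where "open W" "(f i \<in> W) \<noteq> (g i \<in> W)"
    using Topological_Spaces.t0_space[OF \<open>f i \<noteq> g i\<close>] by blast
  then show "\<exists>U. open U \<and> \<not> (f \<in> U \<longleftrightarrow> g \<in> U)"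
    using open_coordinate_preimage[of W i] by (intro exI[of _ "{h. h i \<in> W}"]) auto
qed

instance "fun" :: (type, t1_space) t1_space
proof
  fix f g :: "'a \<Rightarrow> 'b"
  assume "f \<noteq> g"
  then obtain i where "f i \<noteq> g i"
    by (meson ext)
  then obtain W where "open W" "f i \<in> W" "g i \<notin> W"
    using Topological_Spaces.t1_space[OF \<open>f i \<noteq> g i\<close>] by blast
  then show "\<exists>U. open U \<and> f \<in> U \<and> g \<notin> U"
    using open_coordinate_preimage[of W i] by (intro exI[of _ "{h. h i \<in> W}"]) auto
qed

instance "fun" :: (type, t2_space) t2_space
proof
  fix f g :: "'a \<Rightarrow> 'b"
  assume "f \<noteq> g"
  then obtain i where "f i \<noteq> g i"
    by (meson ext)
  then obtain V W where "open V" "open W" "f i \<in> V" "g i \<in> W" "V \<inter> W = {}"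
    using hausdorff[OF \<open>f i \<noteq> g i\<close>] by blast
  then show "\<exists>U U'. open U \<and> open U' \<and> f \<in> U \<and> g \<in> U' \<and> U \<inter> U' = {}"
    using open_coordinate_preimage[of V i] open_coordinate_preimage[of W i]
    by (intro exI[of _ "{h. h i \<in> V}"] exI[of _ "{h. h i \<in> W}"]) auto
qed

text \<open>
  The theorem for Hausdorff types is transported along the evaluation map, which sends a point
  \<open>x\<close> to the family of all values \<open>g x\<close> with \<open>g \<in> R\<close>. Since \<open>R\<close> separates points, this is a
  homeomorphism of the compact space onto a subset of a power of the reals.
\<close>

lemma Stone_Weierstrass_topology:
  fixes X :: "'a topology" and R :: "('a \<Rightarrow> real) set"
  assumes comp: "compact_space X"
    and cont: "\<And>g. g \<in> R \<Longrightarrow> continuous_map X euclideanreal g"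
    and add: "\<And>g h. g \<in> R \<Longrightarrow> h \<in> R \<Longrightarrow> (\<lambda>x. g x + h x) \<in> R"
    and mult: "\<And>g h. g \<in> R \<Longrightarrow> h \<in> R \<Longrightarrow> (\<lambda>x. g x * h x) \<in> R"
    and const: "\<And>c. (\<lambda>_. c) \<in> R"
    and sep: "\<And>x y. \<lbrakk>x \<in> topspace X; y \<in> topspace X; x \<noteq> y\<rbrakk> \<Longrightarrow> \<exists>g\<in>R. g x \<noteq> g y"
    and f: "continuous_map X euclideanreal f" and "0 < e"
  shows "\<exists>g\<in>R. \<forall>x\<in>topspace X. \<bar>f x - g x\<bar> < e"
proof -
  define \<Phi> :: "'a \<Rightarrow> ('a \<Rightarrow> real) \<Rightarrow> real" where "\<Phi> x = (\<lambda>g. if g \<in> R then g x else 0)" for x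
  define S where "S = \<Phi> ` topspace X"
  have "continuous_map X euclideanreal (\<lambda>x. \<Phi> x g)" for g
    by (cases "g \<in> R") (auto simp: \<Phi>_def cont)
  then have "continuous_map X euclidean \<Phi>"
    by (simp add: euclidean_product_topology[symmetric] continuous_map_componentwise_UNIV)
  then have cont_\<Phi>: "continuous_map X (top_of_set S) \<Phi>"
    by (auto simp: continuous_map_in_subtopology S_def)
  have "Hausdorff_space (powertop_real (UNIV :: ('a \<Rightarrow> real) set))"
    by (simp add: Hausdorff_space_product_topology)
  then have Haus: "Hausdorff_space (top_of_set S)"
    by (simp add: euclidean_product_topology Hausdorff_space_subtopology)
  have "inj_on \<Phi> (topspace X)"
  proof (rule inj_onI, rule ccontr)
    fix x y assume xy: "x \<in> topspace X" "y \<in> topspace X" "\<Phi> x = \<Phi> y" "x \<noteq> y"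
    obtain g where "g \<in> R" "g x \<noteq> g y"
      using sep[OF xy(1,2,4)] by blast
    then show False
      using fun_cong[OF xy(3), of g] by (simp add: \<Phi>_def)
  qed
  then have "homeomorphic_map X (top_of_set S) \<Phi>"
    using cont_\<Phi> comp Haus by (intro continuous_imp_homeomorphic_map) (auto simp: S_def)
  then obtain \<Psi> where "homeomorphic_maps X (top_of_set S) \<Phi> \<Psi>"
    using homeomorphic_map_maps by blast
  then have \<Psi>: "continuous_map (top_of_set S) X \<Psi>" "\<And>x. x \<in> topspace X \<Longrightarrow> \<Psi> (\<Phi> x) = x"
    by (auto simp: homeomorphic_maps_def)
  have cont_via: "continuous_on S (\<lambda>w. h (\<Psi> w))" if "continuous_map X euclideanreal h" for h
    using continuous_map_compose[OF \<Psi>(1) that] by (simp add: o_def)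
  define Q where "Q = {w. continuous_on S w \<and> (\<exists>g\<in>R. \<forall>x\<in>topspace X. w (\<Phi> x) = g x)}"
  interpret function_ring_on Q S
  proof
    have "compactin (top_of_set S) S"
      using image_compactin[OF comp[unfolded compact_space_def] cont_\<Phi>] by (simp add: S_def)
    then show "compact S"
      by (simp add: compactin_subtopology)
    show "continuous_on S w" if "w \<in> Q" for w
      using that by (simp add: Q_def)
    show "(\<lambda>z. w z + w' z) \<in> Q" if "w \<in> Q" "w' \<in> Q" for w w'
      using that add unfolding Q_def by (fastforce intro: continuous_on_add)
    show "(\<lambda>z. w z * w' z) \<in> Q" if "w \<in> Q" "w' \<in> Q" for w w'
      using that mult unfolding Q_def by (fastforce intro: continuous_on_mult)
    show "(\<lambda>_. c) \<in> Q" for c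
      using const unfolding Q_def by fastforce
    show "\<exists>w\<in>Q. w z \<noteq> w z'" if z: "z \<in> S" "z' \<in> S" "z \<noteq> z'" for z z'
    proof -
      obtain x x' where x: "x \<in> topspace X" "z = \<Phi> x" "x' \<in> topspace X" "z' = \<Phi> x'"
        using z by (auto simp: S_def)
      then obtain g where "g \<in> R" "g x \<noteq> g x'"
        using sep z(3) by blast
      then show ?thesis
        using x \<Psi>(2) cont_via[OF cont] by (intro bexI[of _ "\<lambda>w. g (\<Psi> w)"]) (auto simp: Q_def)
    qed
  qed
  obtain w where w: "w \<in> Q" "\<forall>z\<in>S. \<bar>f (\<Psi> z) - w z\<bar> < e"
    using Stone_Weierstrass_basic[OF cont_via[OF f] \<open>0 < e\<close>] by blast
  then obtain g where "g \<in> R" "\<forall>x\<in>topspace X. w (\<Phi> x) = g x"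
    by (auto simp: Q_def)
  then show ?thesis
    using w(2) \<Psi>(2) by (intro bexI[of _ g]) (auto simp: S_def)
qed

section \<open>The distance on the product limit\<close>

lemma div_one_plus_subadditive:
  fixes a b c :: real
  assumes "0 \<le> a" "0 \<le> b" "0 \<le> c" "a \<le> b + c"
  shows "a / (1 + a) \<le> b / (1 + b) + c / (1 + c)"
proof -
  have "a / (1 + a) \<le> (b + c) / (1 + (b + c))"
    using assms by (simp add: divide_simps) (simp add: algebra_simps)
  also have "\<dots> = b / (1 + (b + c)) + c / (1 + (b + c))"
    by (simp add: add_divide_distrib)
  also have "\<dots> \<le> b / (1 + b) + c / (1 + c)"
    using assms by (intro add_mono divide_left_mono) auto
  finally show ?thesis .
qed

lemma dist_infty_upper:
  assumes "\<forall>J\<in>A. Metric_space (E J) (d J)" "J \<in> A"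
  shows "d J (x J) (y J) / (1 + d J (x J) (y J)) \<le> dist_infty A d x y"
  unfolding dist_infty_def
proof (rule cSUP_upper[OF \<open>J \<in> A\<close>], rule bdd_aboveI2[where M = 1])
  fix K assume "K \<in> A"
  then have "0 \<le> d K (x K) (y K)"
    using assms(1) Metric_space.nonneg by metis
  then show "d K (x K) (y K) / (1 + d K (x K) (y K)) \<le> 1"
    by simp
qed

lemma Metric_space_dist_infty:
  assumes "A \<noteq> {}" and d: "\<forall>J\<in>A. Metric_space (E J) (d J)"
  shows "Metric_space (Pi\<^sub>E A E) (dist_infty A d)"
proof
  note upper = dist_infty_upper[OF d]
  have d_nonneg: "0 \<le> d J (x J) (y J)" if "J \<in> A" for J x y
    using Metric_space.nonneg[OF d[rule_format, OF that]] .
  show nonneg: "0 \<le> dist_infty A d x y" for x y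
  proof -
    obtain J where "J \<in> A"
      using \<open>A \<noteq> {}\<close> by blast
    then show ?thesis
      using d_nonneg[of J x y] upper[of J x y] by (smt (verit) divide_nonneg_nonneg)
  qed
  have "d J (x J) (y J) = d J (y J) (x J)" if "J \<in> A" for J x y
    using Metric_space.commute[OF d[rule_format, OF that]] .
  then show "dist_infty A d x y = dist_infty A d y x" for x y
    unfolding dist_infty_def by (intro SUP_cong) simp_all
  show "dist_infty A d x y = 0 \<longleftrightarrow> x = y" if xy: "x \<in> Pi\<^sub>E A E" "y \<in> Pi\<^sub>E A E" for x y
  proof
    assume "x = y"
    have "d J (y J) (y J) = 0" if "J \<in> A" for J
      using Metric_space.zero[OF d[rule_format, OF that], of "y J" "y J"] xy(2) that by auto
    then show "dist_infty A d x y = 0"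
      using \<open>x = y\<close> \<open>A \<noteq> {}\<close> by (simp add: dist_infty_def)
  next
    assume 0: "dist_infty A d x y = 0"
    show "x = y"
    proof (rule PiE_ext[OF xy])
      fix J assume "J \<in> A"
      have "d J (x J) (y J) \<le> 0"
        using upper[OF \<open>J \<in> A\<close>, of x y] d_nonneg[OF \<open>J \<in> A\<close>, of x y]
        by (auto simp: 0 divide_le_0_iff)
      then have "d J (x J) (y J) = 0"
        using d_nonneg[OF \<open>J \<in> A\<close>, of x y] by simp
      then show "x J = y J"
        using Metric_space.zero[OF d[rule_format, OF \<open>J \<in> A\<close>], of "x J" "y J"] xy \<open>J \<in> A\<close> by auto
    qed
  qed
  show "dist_infty A d x z \<le> dist_infty A d x y + dist_infty A d y z"
    if xyz: "x \<in> Pi\<^sub>E A E" "y \<in> Pi\<^sub>E A E" "z \<in> Pi\<^sub>E A E" for x y z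
  proof -
    have "d J (x J) (z J) / (1 + d J (x J) (z J)) \<le> dist_infty A d x y + dist_infty A d y z"
      if "J \<in> A" for J
    proof -
      have "d J (x J) (z J) \<le> d J (x J) (y J) + d J (y J) (z J)"
        using Metric_space.triangle[OF d[rule_format, OF that]] xyz that by (auto simp: PiE_iff)
      then show ?thesis
        using div_one_plus_subadditive[OF d_nonneg d_nonneg d_nonneg, OF that that that]
          upper[OF that, of x y] upper[OF that, of y z] by (meson add_mono order_trans)
    qed
    then show ?thesis
      unfolding dist_infty_def[of A d x z] using \<open>A \<noteq> {}\<close> by (intro cSUP_least) auto
  qed
qed

lemma continuous_map_dist_infty_coordinate:
  assumes "A \<noteq> {}" and d: "\<forall>J\<in>A. Metric_space (E J) (d J)"
    and X: "X \<subseteq> Pi\<^sub>E A E" and "J \<in> A"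
  shows "continuous_map (Metric_space.mtopology X (dist_infty A d))
           (Metric_space.mtopology (E J) (d J)) (\<lambda>x. x J)"
proof -
  interpret Metric_space X "dist_infty A d"
    using Metric_space.subspace[OF Metric_space_dist_infty[OF \<open>A \<noteq> {}\<close> d] X] .
  show ?thesis
    unfolding metric_continuous_map[OF d[rule_format, OF \<open>J \<in> A\<close>]]
  proof (intro conjI ballI allI impI)
    show "(\<lambda>x. x J) ` X \<subseteq> E J"
      using X \<open>J \<in> A\<close> by auto
    fix x and \<epsilon> :: real
    assume "0 < \<epsilon>"
    \<comment> \<open>Since \<open>t / (1 + t)\<close> is strictly increasing, \<open>\<epsilon> / (1 + \<epsilon>)\<close> is the bound for it that forces \<open>t < \<epsilon>\<close>.\<close>
    have "d J (x J) (y J) < \<epsilon>" if "dist_infty A d x y < \<epsilon> / (1 + \<epsilon>)" for y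
    proof -
      have "0 \<le> d J (x J) (y J)"
        using Metric_space.nonneg[OF d[rule_format, OF \<open>J \<in> A\<close>]] .
      moreover have "d J (x J) (y J) / (1 + d J (x J) (y J)) < \<epsilon> / (1 + \<epsilon>)"
        using dist_infty_upper[OF d \<open>J \<in> A\<close>, of x y] that by linarith
      ultimately show ?thesis
        using \<open>0 < \<epsilon>\<close> by (simp add: divide_simps split: if_splits) (simp add: algebra_simps)
    qed
    then show "\<exists>\<delta>>0. \<forall>y. y \<in> X \<and> dist_infty A d x y < \<delta> \<longrightarrow> d J (x J) (y J) < \<epsilon>"
      using \<open>0 < \<epsilon>\<close> by (intro exI[of _ "\<epsilon> / (1 + \<epsilon>)"]) auto
  qed
qed

section \<open>Functions of one coordinate\<close>

text \<open>Maximal antichains are sections, and Zorn's lemma extends \<open>{J}\<close> to one.\<close>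

lemma section_containing:
  assumes "J \<in> A"
  obtains S where "S \<in> Sec A" "J \<in> S"
proof -
  define AC where "AC = {S. J \<in> S \<and> S \<subseteq> A \<and> (\<forall>I\<in>S. \<forall>K\<in>S. I \<le> K \<longrightarrow> I = K)}"
  have "\<exists>S\<in>AC. \<forall>S'\<in>AC. S \<subseteq> S' \<longrightarrow> S' = S"
  proof (rule subset_Zorn_nonempty)
    show "AC \<noteq> {}"
      using assms by (auto simp: AC_def intro!: exI[of _ "{J}"])
    fix \<C> assume "\<C> \<noteq> {}" and chain: "subset.chain AC \<C>"
    have sub: "\<C> \<subseteq> AC"
      using chain by (simp add: subset.chain_def)
    have "I = K" if IK: "I \<in> S" "S \<in> \<C>" "K \<in> S'" "S' \<in> \<C>" "I \<le> K" for I K S S'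
    proof -
      have "S \<subseteq> S' \<or> S' \<subseteq> S"
        using chain IK(2,4) by (auto simp: subset_chain_def)
      then obtain S'' where "S'' \<in> \<C>" "I \<in> S''" "K \<in> S''"
        using IK by blast
      then show ?thesis
        using sub \<open>I \<le> K\<close> by (auto simp: AC_def)
    qed
    then show "\<Union>\<C> \<in> AC"
      using \<open>\<C> \<noteq> {}\<close> sub by (auto simp: AC_def)
  qed
  then obtain S where S: "S \<in> AC" and max: "\<And>S'. S' \<in> AC \<Longrightarrow> S \<subseteq> S' \<Longrightarrow> S' = S"
    by blast
  have "\<exists>s\<in>S. I \<le> s \<or> s \<le> I" if "I \<in> A" for I
  proof (rule ccontr)
    assume incomparable: "\<not> ?thesis"
    then have "insert I S \<in> AC"
      using S \<open>I \<in> A\<close> by (auto simp: AC_def)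
    then have "I \<in> S"
      using max[of "insert I S"] by blast
    then show False
      using incomparable by blast
  qed
  then have "S \<in> Sec A"
    using S unfolding AC_def Sec_def by (auto dest: order.antisym)
  then show thesis
    using S that by (simp add: AC_def)
qed

text \<open>
  Dependence on coordinate \<open>J\<close> is tested on the points of \<open>X\<close> only, so that on a product limit a
  function of coordinate \<open>J\<close> is also one of every coordinate above \<open>J\<close>.
\<close>

definition coordinate_functions ::
  "'i set \<Rightarrow> ('i \<Rightarrow> 'e manifold) \<Rightarrow> ('i \<Rightarrow> 'e) topology \<Rightarrow> (('i \<Rightarrow> 'e) \<Rightarrow> real) set" where
  "coordinate_functions A M X =
     {f. continuous_map X euclideanreal f \<and>
         (\<forall>n U p. plot A M (topspace X) n U p \<longrightarrow> smooth_real_on n U (\<lambda>u. f (p u))) \<and>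
         (\<exists>J\<in>A. \<forall>x\<in>topspace X. \<forall>y\<in>topspace X. x J = y J \<longrightarrow> f x = f y)}"

lemma coordinate_functionsE:
  assumes "f \<in> coordinate_functions A M X"
  obtains J where "J \<in> A"
    "\<And>x y. x \<in> topspace X \<Longrightarrow> y \<in> topspace X \<Longrightarrow> x J = y J \<Longrightarrow> f x = f y"
  using assms unfolding coordinate_functions_def by blast

lemma coordinate_functions_continuous:
  "f \<in> coordinate_functions A M X \<Longrightarrow> continuous_map X euclideanreal f"
  unfolding coordinate_functions_def by blast

lemma coordinate_functions_smooth:
  "f \<in> coordinate_functions A M X \<Longrightarrow> plot A M (topspace X) n U p \<Longrightarrow>
     smooth_real_on n U (\<lambda>u. f (p u))"
  unfolding coordinate_functions_def by blast

text \<open>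
  A section \<open>S\<close> through \<open>J\<close> leaves the coordinate \<open>J\<close> unchanged in \<^const>\<open>section_projection\<close>, so a
  function of this coordinate is cylindrical for \<open>S\<close>.
\<close>

lemma restrict_coordinate_function_in_Cyl:
  assumes f: "f \<in> coordinate_functions A M X" and "Y \<subseteq> topspace X"
  shows "restrict f Y \<in> Cyl A M \<pi> \<iota> Y"
proof -
  obtain J where "J \<in> A"
    and fJ: "\<And>x y. x \<in> topspace X \<Longrightarrow> y \<in> topspace X \<Longrightarrow> x J = y J \<Longrightarrow> f x = f y"
    by (rule coordinate_functionsE[OF f]) blast
  obtain S where "S \<in> Sec A" "J \<in> S"
    using section_containing[OF \<open>J \<in> A\<close>] .
  have "smooth_real_on n U (\<lambda>u. restrict f Y (p u))" if p: "plot A M Y n U p" for n U p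
  proof -
    have "plot A M (topspace X) n U p"
      using p \<open>Y \<subseteq> topspace X\<close> by (auto simp: plot_def)
    then have "smooth_real_on n U (\<lambda>u. f (p u))"
      by (rule coordinate_functions_smooth[OF f])
    moreover have U: "openin (Euclidean_space n) U"
      using p by (simp add: plot_def)
    have eq: "f (p u) = restrict f Y (p u)" if "u \<in> U" for u
      using p that by (auto simp: plot_def)
    have "Ck_on n k U (\<lambda>u. restrict f Y (p u))" if "Ck_on n k U (\<lambda>u. f (p u))" for k
      by (rule Ck_on_cong_imp[OF U that eq])
    ultimately show ?thesis
      by (simp add: smooth_real_on_def)
  qed
  then have "restrict f Y \<in> smooth_functions A M Y"
    by (simp add: smooth_functions_def)
  moreover have "restrict f Y x = restrict f Y y"
    if "x \<in> Y" "y \<in> Y" "section_projection A \<pi> \<iota> S x y" for x y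
  proof -
    have "y J = x J"
      using that(3) \<open>J \<in> A\<close> \<open>J \<in> S\<close> by (auto simp: section_projection_def)
    then show ?thesis
      using fJ[of x y] that \<open>Y \<subseteq> topspace X\<close> by auto
  qed
  ultimately show ?thesis
    using \<open>S \<in> Sec A\<close> by (auto simp: Cyl_def)
qed

lemma coordinate_functions_const:
  assumes "A \<noteq> {}"
  shows "(\<lambda>_. c) \<in> coordinate_functions A M X"
  using assms by (auto simp: coordinate_functions_def smooth_real_on_def plot_def Ck_on_const)

text \<open>
  Addition and multiplication need the same argument: pass to a common upper bound \<open>K\<close> of the two
  indices, whose coordinate determines the other two by projection.
\<close>

lemma coordinate_functions_combine:
  assumes "directed A" and X: "topspace X \<subseteq> product_limit A E \<pi>"
    and f: "f \<in> coordinate_functions A M X" and g: "g \<in> coordinate_functions A M X"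
    and cont: "continuous_map X euclideanreal (\<lambda>x. h (f x) (g x))"
    and smooth: "\<And>n k U F G. openin (Euclidean_space n) U \<Longrightarrow> Ck_on n k U F \<Longrightarrow> Ck_on n k U G \<Longrightarrow>
                   Ck_on n k U (\<lambda>u. h (F u) (G u))"
  shows "(\<lambda>x. h (f x) (g x)) \<in> coordinate_functions A M X"
proof -
  obtain I where "I \<in> A"
    and fI: "\<And>x y. x \<in> topspace X \<Longrightarrow> y \<in> topspace X \<Longrightarrow> x I = y I \<Longrightarrow> f x = f y"
    by (rule coordinate_functionsE[OF f]) blast
  obtain J where "J \<in> A"
    and gJ: "\<And>x y. x \<in> topspace X \<Longrightarrow> y \<in> topspace X \<Longrightarrow> x J = y J \<Longrightarrow> g x = g y"
    by (rule coordinate_functionsE[OF g]) blast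
  obtain K where K: "K \<in> A" "I \<le> K" "J \<le> K"
    using \<open>directed A\<close> \<open>I \<in> A\<close> \<open>J \<in> A\<close> by (auto simp: directed_def)
  have proj: "x I = \<pi> I K (x K) \<and> x J = \<pi> J K (x K)" if "x \<in> topspace X" for x
    using X that K \<open>I \<in> A\<close> \<open>J \<in> A\<close> by (auto simp: product_limit_def)
  have "h (f x) (g x) = h (f y) (g y)" if "x \<in> topspace X" "y \<in> topspace X" "x K = y K" for x y
    using fI[OF that(1,2)] gJ[OF that(1,2)] proj[OF that(1)] proj[OF that(2)] that(3) by simp
  moreover have "smooth_real_on n U (\<lambda>u. h (f (p u)) (g (p u)))"
    if p: "plot A M (topspace X) n U p" for n U p
  proof -
    have "openin (Euclidean_space n) U"
      using p by (simp add: plot_def)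
    moreover have "smooth_real_on n U (\<lambda>u. f (p u))" "smooth_real_on n U (\<lambda>u. g (p u))"
      using coordinate_functions_smooth[OF f p] coordinate_functions_smooth[OF g p] by auto
    ultimately show ?thesis
      unfolding smooth_real_on_def using smooth by simp
  qed
  ultimately show ?thesis
    using cont \<open>K \<in> A\<close> unfolding coordinate_functions_def by blast
qed

lemma coordinate_functions_add:
  assumes "directed A" "topspace X \<subseteq> product_limit A E \<pi>"
    "f \<in> coordinate_functions A M X" "g \<in> coordinate_functions A M X"
  shows "(\<lambda>x. f x + g x) \<in> coordinate_functions A M X"
  by (rule coordinate_functions_combine[where h = "(+)", OF assms])
    (use assms(3,4)[THEN coordinate_functions_continuous] in \<open>auto intro: continuous_map_add Ck_on_add\<close>)

lemma coordinate_functions_mult: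
  assumes "directed A" "topspace X \<subseteq> product_limit A E \<pi>"
    "f \<in> coordinate_functions A M X" "g \<in> coordinate_functions A M X"
  shows "(\<lambda>x. f x * g x) \<in> coordinate_functions A M X"
  by (rule coordinate_functions_combine[where h = "(*)", OF assms])
    (use assms(3,4)[THEN coordinate_functions_continuous] in \<open>auto intro: continuous_map_real_mult Ck_on_mult\<close>)

lemma coordinate_functions_separate_points:
  assumes M: "\<And>J. J \<in> A \<Longrightarrow> smooth_manifold (M J)"
    and coord: "\<And>J. J \<in> A \<Longrightarrow> continuous_map X (mtop (M J)) (\<lambda>x. x J)"
    and ext: "topspace X \<subseteq> extensional A"
    and xy: "x \<in> topspace X" "y \<in> topspace X" "x \<noteq> y"
  shows "\<exists>f\<in>coordinate_functions A M X. f x \<noteq> f y"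
proof -
  obtain J where "J \<in> A" "x J \<noteq> y J"
    using xy ext extensionalityI[of x A y] by blast
  have "x J \<in> topspace (mtop (M J))" "y J \<in> topspace (mtop (M J))"
    using continuous_map_funspace[OF coord[OF \<open>J \<in> A\<close>]] xy(1,2) by auto
  then obtain g where g: "continuous_map (mtop (M J)) euclideanreal g" "smooth_on_params (M J) g"
    "g (x J) \<noteq> g (y J)"
    by (rule smooth_function_separates_points[OF M[OF \<open>J \<in> A\<close>] _ _ \<open>x J \<noteq> y J\<close>])
  have "(\<lambda>x. g (x J)) \<in> coordinate_functions A M X"
    unfolding coordinate_functions_def
  proof (intro CollectI conjI allI impI)
    show "continuous_map X euclideanreal (\<lambda>x. g (x J))"
      using continuous_map_compose[OF coord[rule_format, OF \<open>J \<in> A\<close>] g(1)] by (simp add: o_def)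
    show "smooth_real_on n U (\<lambda>u. g (p u J))" if "plot A M (topspace X) n U p" for n U p
      using g(2) that \<open>J \<in> A\<close> by (auto simp: plot_def smooth_on_params_def)
    show "\<exists>J'\<in>A. \<forall>x\<in>topspace X. \<forall>y\<in>topspace X. x J' = y J' \<longrightarrow> g (x J) = g (y J)"
      using \<open>J \<in> A\<close> by (intro bexI[of _ J]) auto
  qed
  then show ?thesis
    using g(3) by (intro bexI[of _ "\<lambda>x. g (x J)"])
qed

text \<open>The polynomial is \<open>X\<^sub>1\<close>.\<close>

lemma Cyl_on_limit_imp_poly_cylindrical:
  assumes "f \<in> Cyl_on_limit A E M \<pi> \<iota>"
  shows "f \<in> poly_cylindrical A E M \<pi> \<iota>"
proof -
  define P :: real_mpoly where "P = Poly_Mapping.single (Poly_Mapping.single 1 1) 1"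
  have "P \<in> mpolys 1"
    by (simp add: P_def mpolys_def)
  moreover have "f \<in> extensional (product_limit A E \<pi>)"
    using assms unfolding Cyl_on_limit_def Cyl_def smooth_functions_def by blast
  then have "f = (\<lambda>x\<in>product_limit A E \<pi>. eval_mpoly P (\<lambda>_. f x))"
    by (intro extensionalityI[OF _ restrict_extensional]) (auto simp: P_def eval_mpoly_def)
  ultimately show ?thesis
    using assms unfolding poly_cylindrical_def
    by (intro UN_I[of 1] CollectI exI[of _ P] exI[of _ "\<lambda>_. f"]) auto
qed

section \<open>Uniform density\<close>

text \<open>
  Compactness makes every continuous function bounded, so that the space of bounded continuous
  functions contains \<open>R\<close> after restriction. The elements of that space are extensional, hence the
  restriction.
\<close>

lemma uniform_topology_closure_of_eq_topspace:
  assumes comp: "compact_space X"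
    and cont: "\<And>g. g \<in> R \<Longrightarrow> continuous_map X euclideanreal g"
    and dense: "\<And>f e. continuous_map X euclideanreal f \<Longrightarrow> 0 < e \<Longrightarrow>
                  \<exists>g\<in>R. \<forall>x\<in>topspace X. \<bar>f x - g x\<bar> < e"
    and D: "\<And>g. g \<in> R \<Longrightarrow> restrict g (topspace X) \<in> D"
  shows "uniform_topology X closure_of D = topspace (uniform_topology X)"
proof -
  let ?C = "cfunspace X (euclidean_metric :: real metric)"
  interpret C: Metric_space "mspace ?C" "mdist ?C"
    by (rule Metric_space_mspace_mdist)
  have mspace: "f \<in> mspace ?C \<longleftrightarrow> f \<in> extensional (topspace X) \<and> continuous_map X euclideanreal f" for f
  proof -
    have "bounded (f ` topspace X)" if "continuous_map X euclideanreal f"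
      using image_compactin[OF comp[unfolded compact_space_def] that]
      by (simp add: compact_imp_bounded)
    then show ?thesis
      by auto
  qed
  have "\<exists>h\<in>D. h \<in> C.mball f r" if f: "f \<in> mspace ?C" and "0 < r" for f r
  proof -
    obtain g where g: "g \<in> R" "\<forall>x\<in>topspace X. \<bar>f x - g x\<bar> < r / 2"
      using dense[of f "r / 2"] f \<open>0 < r\<close> mspace by auto
    have "continuous_map X euclideanreal (restrict g (topspace X))"
      by (rule continuous_map_eq[OF cont[OF g(1)]]) simp
    then have "restrict g (topspace X) \<in> mspace ?C"
      using mspace by simp
    moreover have "mdist ?C f (restrict g (topspace X)) \<le> r / 2"
      using g(2) \<open>0 < r\<close> by (intro mdist_cfunspace_le) (auto simp: dist_real_def less_imp_le)
    ultimately have "restrict g (topspace X) \<in> C.mball f r"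
      using f \<open>0 < r\<close> by (simp del: mspace_cfunspace)
    then show ?thesis
      using D[OF g(1)] by blast
  qed
  then show ?thesis
    unfolding uniform_topology_def mtopology_of_def C.metric_closure_of C.topspace_mtopology
    by blast
qed

theorem theorem6p5:
  fixes A :: "'i::order set"
    and E :: "'i \<Rightarrow> 'e set"
    and \<pi> \<iota> :: "'i \<Rightarrow> 'i \<Rightarrow> 'e \<Rightarrow> 'e"
    and M :: "'i \<Rightarrow> 'e manifold"
    and d :: "'i \<Rightarrow> 'e \<Rightarrow> 'e \<Rightarrow> real"
  assumes "A \<noteq> {}" and "directed A"
    and "diffeological_profinite_fam A E \<pi> M \<iota>"
    and "\<And>J. J \<in> A \<Longrightarrow> Metric_space (E J) (d J)"
    and "\<And>J. J \<in> A \<Longrightarrow> Metric_space.mtopology (E J) (d J) = mtop (M J)"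
    and "\<And>J K x y. \<lbrakk>J \<in> A; K \<in> A; J \<le> K; x \<in> E J; y \<in> E J\<rbrakk> \<Longrightarrow>
           d J x y = d K (\<iota> K J x) (\<iota> K J y)"
    and "compact_space (limit_topology A E \<pi> d)"
  shows "uniform_topology (limit_topology A E \<pi> d) closure_of poly_cylindrical A E M \<pi> \<iota>
           = topspace (uniform_topology (limit_topology A E \<pi> d))"
proof -
  interpret diffeological_profinite_fam A E \<pi> M \<iota>
    by fact
  let ?X = "limit_topology A E \<pi> d" and ?L = "product_limit A E \<pi>"
  have L: "?L \<subseteq> Pi\<^sub>E A E"
    by (auto simp: product_limit_def)
  have d: "\<forall>J\<in>A. Metric_space (E J) (d J)"
    using assms(4) by blast
  have top: "topspace ?X = ?L"
    using Metric_space.topspace_mtopology[OF Metric_space.subspace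
        [OF Metric_space_dist_infty[OF assms(1) d] L]]
    by (simp add: limit_topology_def)
  have coord: "continuous_map ?X (mtop (M J)) (\<lambda>x. x J)" if "J \<in> A" for J
    using continuous_map_dist_infty_coordinate[OF assms(1) d L that] assms(5)[OF that]
    by (simp add: limit_topology_def)
  define R where "R = coordinate_functions A M ?X"
  have cont: "continuous_map ?X euclideanreal g" if "g \<in> R" for g
    using that coordinate_functions_continuous by (auto simp: R_def)
  show ?thesis
  proof (rule uniform_topology_closure_of_eq_topspace[OF assms(7) cont])
    fix f e assume f: "continuous_map ?X euclideanreal f" and "0 < (e :: real)"
    show "\<exists>g\<in>R. \<forall>x\<in>topspace ?X. \<bar>f x - g x\<bar> < e"
    proof (rule Stone_Weierstrass_topology[OF assms(7) cont _ _ _ _ f \<open>0 < e\<close>])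
      show "(\<lambda>x. g x + h x) \<in> R" if "g \<in> R" "h \<in> R" for g h
        using coordinate_functions_add[OF assms(2)] that top unfolding R_def by blast
      show "(\<lambda>x. g x * h x) \<in> R" if "g \<in> R" "h \<in> R" for g h
        using coordinate_functions_mult[OF assms(2)] that top unfolding R_def by blast
      show "(\<lambda>_. c) \<in> R" for c
        using coordinate_functions_const[OF assms(1)] by (simp add: R_def)
      show "\<exists>g\<in>R. g x \<noteq> g y" if "x \<in> topspace ?X" "y \<in> topspace ?X" "x \<noteq> y" for x y
        unfolding R_def
        using coordinate_functions_separate_points[OF manifold coord _ that] top L
        by (auto simp: PiE_def)
    qed
  next
    fix g assume "g \<in> R"
    have sub: "profinite_limit A E \<pi> \<iota> \<subseteq> ?L"
      by (auto simp: profinite_limit_def section_limit_def)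
    have "restrict g Y \<in> Cyl A M \<pi> \<iota> Y" if "Y \<subseteq> ?L" for Y
      using restrict_coordinate_function_in_Cyl[of g A M ?X Y] \<open>g \<in> R\<close> that top by (simp add: R_def)
    then have "restrict g ?L \<in> Cyl_on_limit A E M \<pi> \<iota>"
      using sub by (auto simp: Cyl_on_limit_def restrict_restrict Int_absorb1)
    then show "restrict g (topspace ?X) \<in> poly_cylindrical A E M \<pi> \<iota>"
      using top Cyl_on_limit_imp_poly_cylindrical by simp
  qed
qed

end
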